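(* Let $r,\lambda\in\mathbb{R}$ and $T>0$ be constants, let $\Omega=[0,\infty)$, and consider the initial value problem $$\partial_t u(t,x)= r x\,u_x(t,x)-\frac{\lambda^2}{2}\,\frac{u_x(t,x)^2}{u_{xx}(t,x)},\quad (t,x)\in[0,T]\times\Omega,\qquad u(0,x)=2e^{-\frac12 x},\quad x\in\Omega. \tag{P}$$ For $\theta=(\theta_0,\theta_1)=(\log\alpha,\log\beta)\in\mathbb{R}^2$ (so $\alpha,\beta>0$), consider the trial function $$u_\theta(x)=\alpha\sqrt{\beta}\,e^{-\frac12\beta x},\qquad x\ge 0.$$ Then the matrix $M(\theta)$ and the vector $V(\theta)$ of the Nonlinear Galerkin method for (P) with this trial family (with index order $(\theta_0,\theta_1)$) are $$M(\theta)=\alpha^2\begin{bmatrix}1&0\\0&\frac14\end{bmatrix},\qquad V(\theta)=\alpha^2\begin{bmatrix}-\frac12(\lambda^2+r)\\ \frac14 r\end{bmatrix}.$$ The solution of the Nonlinear Galerkin evolution equation $M(\theta(t))\theta'(t)=V(\theta(t))$ with initial parameters $\alpha(0)=2$, $\beta(0)=1$ (for which $u_{\theta(0)}(x)=2e^{-x/2}$) is $$\alpha(t)=2e^{-\frac12(\lambda^2+r)t},\qquad \beta(t)=e^{rt}.$$ Moreover, the resulting function $u(t,x)=u_{\theta(t)}(x)=\alpha(t)\sqrt{\beta(t)}\,e^{-\frac12\beta(t)x}$ is an exact solution of the initial value problem (P).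
   Context: Nonlinear Galerkin (NG) method. Let $\Omega\subseteq\mathbb{R}^d$ and let $\langle f_1|f_2\rangle=\int_\Omega \overline{f_1(x)}f_2(x)\,dx$ be the $L^2(\Omega)$ inner product. Given a time-dependent PDE $\partial_t u=F[\,\cdot\,]$, where $F$ depends on the space-time coordinates, $u$, and finitely many spatial derivatives of $u$, and a family of functions $u_\theta:\Omega\to\mathbb{R}$ differentiably parametrized by $\theta\in\mathbb{R}^{p+1}$, let $\widetilde F(t,\theta,x)$ denote the right-hand side $F$ evaluated at time $t$ and point $x$ with $u$ and its spatial derivatives replaced by $u_\theta$ and its spatial derivatives. Define $$M_{ij}(\theta)=\left\langle\frac{\partial u_\theta}{\partial\theta_i}\middle|\frac{\partial u_\theta}{\partial\theta_j}\right\rangle,\qquad V_i(t,\theta)=\left\langle\frac{\partial u_\theta}{\partial\theta_i}\middle|\widetilde F(t,\theta,\cdot)\right\rangle .$$ The NG evolution equation for the parameters is $M(\theta(t))\,\theta'(t)=V(t,\theta(t))$, with $\theta(0)$ chosen so that $u_{\theta(0)}$ matches the initial condition. When $F$ has no explicit time dependence, $V(t,\theta)$ is written $V(\theta)$. *)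

theory Defs
  imports "HOL-Analysis.Analysis"
begin

text \<open>
  Spatial derivatives are one-sided at boundary points of \<open>\<Omega>\<close>: the trial functions and the
  solutions live on \<open>\<Omega>\<close> only, so their values outside \<open>\<Omega>\<close> must not matter.
\<close>

primrec spatial_deriv :: "real set \<Rightarrow> nat \<Rightarrow> (real \<Rightarrow> real) \<Rightarrow> real \<Rightarrow> real" where
  "spatial_deriv \<Omega> 0 f = f"
| "spatial_deriv \<Omega> (Suc k) f =
     (\<lambda>x. vector_derivative (spatial_deriv \<Omega> k f) (at x within \<Omega>))"

definition times_differentiable_on :: "nat \<Rightarrow> real set \<Rightarrow> (real \<Rightarrow> real) \<Rightarrow> bool" where
  "times_differentiable_on n \<Omega> f \<longleftrightarrow> (\<forall>k<n. spatial_deriv \<Omega> k f differentiable_on \<Omega>)"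

text \<open>
  The inner product of \<open>L\<^sup>2(\<Omega>)\<close>. All functions involved are real valued, so the complex
  conjugation in the first argument is omitted.
\<close>

definition in_L2 :: "real set \<Rightarrow> (real \<Rightarrow> real) \<Rightarrow> bool" where
  "in_L2 \<Omega> f \<longleftrightarrow>
     set_borel_measurable lebesgue \<Omega> f \<and> set_integrable lebesgue \<Omega> (\<lambda>x. (f x)\<^sup>2)"

definition L2_inner :: "real set \<Rightarrow> (real \<Rightarrow> real) \<Rightarrow> (real \<Rightarrow> real) \<Rightarrow> real" where
  "L2_inner \<Omega> f g = (LINT x:\<Omega>|lebesgue. f x * g x)"

text \<open>
  The right-hand side of a PDE \<open>\<partial>\<^sub>t u = F\<close> in one space dimension is a function \<open>F t x j\<close>, where
  \<open>j k\<close> stands for the \<open>k\<close>-th spatial derivative of \<open>u\<close> at \<open>(t, x)\<close> (and \<open>j 0\<close> for \<open>u\<close> itself).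
  A trial family is a function \<open>u \<theta> x\<close> with \<open>\<theta> \<in> \<real>\<^sup>n\<close>.
\<close>

type_synonym pde_rhs = "real \<Rightarrow> real \<Rightarrow> (nat \<Rightarrow> real) \<Rightarrow> real"

definition eval_rhs :: "real set \<Rightarrow> pde_rhs \<Rightarrow> real \<Rightarrow> (real \<Rightarrow> real) \<Rightarrow> real \<Rightarrow> real" where
  "eval_rhs \<Omega> F t f x = F t x (\<lambda>k. spatial_deriv \<Omega> k f x)"

definition param_deriv :: "(real^'n \<Rightarrow> real \<Rightarrow> real) \<Rightarrow> real^'n \<Rightarrow> 'n \<Rightarrow> real \<Rightarrow> real" where
  "param_deriv u \<theta> i x = deriv (\<lambda>s. u (\<theta> + s *\<^sub>R axis i 1) x) 0"

definition NG_matrix :: "real set \<Rightarrow> (real^'n \<Rightarrow> real \<Rightarrow> real) \<Rightarrow> real^'n \<Rightarrow> real^'n^'n" where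
  "NG_matrix \<Omega> u \<theta> = (\<chi> i j. L2_inner \<Omega> (param_deriv u \<theta> i) (param_deriv u \<theta> j))"

definition NG_vector ::
    "real set \<Rightarrow> pde_rhs \<Rightarrow> (real^'n \<Rightarrow> real \<Rightarrow> real) \<Rightarrow> real \<Rightarrow> real^'n \<Rightarrow> real^'n" where
  "NG_vector \<Omega> F u t \<theta> = (\<chi> i. L2_inner \<Omega> (param_deriv u \<theta> i) (eval_rhs \<Omega> F t (u \<theta>)))"

definition NG_evolution ::
    "real set \<Rightarrow> pde_rhs \<Rightarrow> (real^'n \<Rightarrow> real \<Rightarrow> real) \<Rightarrow> real \<Rightarrow> (real \<Rightarrow> real^'n) \<Rightarrow> bool" where
  "NG_evolution \<Omega> F u T \<theta> \<longleftrightarrow>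
     (\<forall>t\<in>{0..T}. \<exists>\<theta>'. (\<theta> has_vector_derivative \<theta>') (at t within {0..T}) \<and>
        NG_matrix \<Omega> u (\<theta> t) *v \<theta>' = NG_vector \<Omega> F u t (\<theta> t))"

definition IVP_rhs :: "real \<Rightarrow> real \<Rightarrow> pde_rhs" where
  "IVP_rhs r lam t x j = r * x * j 1 - lam\<^sup>2 / 2 * ((j 1)\<^sup>2 / j 2)"

text \<open>
  Classical solutions on \<open>[0,T] \<times> [0,\<infinity>)\<close>. Since \<open>u\<^sub>x\<^sub>x\<close> is a denominator and division by zero is
  total in HOL, a solution is required to satisfy \<open>u\<^sub>x\<^sub>x \<noteq> 0\<close>.
\<close>

definition solves_IVP :: "real \<Rightarrow> real \<Rightarrow> real \<Rightarrow> (real \<Rightarrow> real \<Rightarrow> real) \<Rightarrow> bool" where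
  "solves_IVP r lam T u \<longleftrightarrow>
     (\<forall>t\<in>{0..T}.
        times_differentiable_on 2 {0..} (u t) \<and>
        (\<forall>x\<in>{0..}. spatial_deriv {0..} 2 (u t) x \<noteq> 0 \<and>
           ((\<lambda>s. u s x) has_real_derivative eval_rhs {0..} (IVP_rhs r lam) t (u t) x)
             (at t within {0..T}))) \<and>
     (\<forall>x\<in>{0..}. u 0 x = 2 * exp (- (1/2) * x))"

text \<open>
  The parameters \<open>\<theta>\<^sub>0, \<theta>\<^sub>1\<close> are the components \<open>\<theta> $ 1, \<theta> $ 2\<close> of a vector in \<open>real^2\<close>; thus
  \<open>\<theta> = vector [ln \<alpha>, ln \<beta>]\<close> with \<open>\<alpha> = trial_alpha \<theta>\<close> and \<open>\<beta> = trial_beta \<theta>\<close>.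
\<close>

definition trial_alpha :: "real^2 \<Rightarrow> real" where
  "trial_alpha \<theta> = exp (\<theta> $ 1)"

definition trial_beta :: "real^2 \<Rightarrow> real" where
  "trial_beta \<theta> = exp (\<theta> $ 2)"

definition trial_fun :: "real^2 \<Rightarrow> real \<Rightarrow> real" where
  "trial_fun \<theta> x =
     trial_alpha \<theta> * sqrt (trial_beta \<theta>) * exp (- (1/2) * trial_beta \<theta> * x)"

end

theory Submission
  imports Defs "HOL-Probability.Distributions"
begin

text \<open>
  The right-hand side of the equation, evaluated on a trial function, already lies in the tangent
  space of the trial manifold. For \<open>u\<^sub>\<theta> = \<alpha> \<surd>\<beta> exp (- \<beta>x/2)\<close> every spatial derivative
  multiplies \<open>u\<^sub>\<theta>\<close> by \<open>-\<beta>/2\<close>, so that \<open>u\<^sub>x\<^sup>2 / u\<^sub>x\<^sub>x = u\<close> and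
  \<open>F = - (\<lambda>\<^sup>2 + r \<beta> x)/2 \<cdot> u\<^sub>\<theta>\<close>, while the parameter derivatives are \<open>u\<^sub>\<theta>\<close> and
  \<open>(1 - \<beta>x)/2 \<cdot> u\<^sub>\<theta>\<close>. Hence \<open>F\<close> is the combination of the parameter derivatives with the
  coefficients \<open>w = (- (\<lambda>\<^sup>2 + r)/2, r)\<close> (lemma \<open>eval_rhs_trial_fun_tangent\<close>), and \<open>w\<close> does not
  depend on \<open>\<theta>\<close>.

  This explains the whole theorem. Taking inner products gives \<open>V = M w\<close>
  (\<open>NG_vector_eq_if_tangent\<close>). As \<open>M\<close> is invertible, the evolution equation says \<open>\<theta>' = w\<close>
  (\<open>NG_evolution_iff_if_tangent\<close>), whose solutions are exactly the straight lines with velocity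
  \<open>w\<close> (\<open>constant_velocity_iff\<close>); in terms of \<open>\<alpha>\<close> and \<open>\<beta>\<close> these are the stated exponentials.
  Along such a line, the chain rule \<open>\<partial>\<^sub>t u = \<Sum>\<^sub>j w\<^sub>j \<partial>u/\<partial>\<theta>\<^sub>j\<close> reproduces \<open>F\<close>, so the Galerkin
  solution solves the equation exactly.

  The computation that remains is the matrix \<open>M\<close>. A product of two tangent vectors is \<open>\<alpha>\<^sup>2\<close> times a
  quadratic polynomial in \<open>\<beta>x\<close> times the density \<open>\<beta> exp (- \<beta>x)\<close>, and the moments of that density
  are read off from the Erlang distributions (\<open>quadratic_exponential_integral\<close>).
\<close>

section \<open>Nonlinear Galerkin equations with an exact tangent field\<close>

lemma param_deriv_eq:
  assumes "((\<lambda>\<eta>. u \<eta> x) has_derivative D) (at \<theta>)"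
  shows "param_deriv u \<theta> i x = D (axis i 1)"
proof -
  interpret D: bounded_linear D
    using assms by (rule has_derivative_bounded_linear)
  have "((\<lambda>s. \<theta> + s *\<^sub>R axis i 1) has_derivative (\<lambda>s. s *\<^sub>R axis i 1)) (at (0::real))"
    by (auto intro!: derivative_eq_intros)
  from has_derivative_compose[OF this, of "\<lambda>\<eta>. u \<eta> x" D]
  have "((\<lambda>s. u (\<theta> + s *\<^sub>R axis i 1) x) has_derivative (\<lambda>s. D (s *\<^sub>R axis i 1))) (at 0)"
    using assms by simp
  then have "((\<lambda>s. u (\<theta> + s *\<^sub>R axis i 1) x) has_real_derivative D (axis i 1)) (at 0)"
    by (simp add: has_field_derivative_def D.scaleR mult_commute_abs)
  then show ?thesis
    unfolding param_deriv_def by (rule DERIV_imp_deriv)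
qed

lemma chain_rule_param_deriv:
  assumes u: "(\<lambda>\<eta>. u \<eta> x) differentiable (at (\<theta> t))"
    and \<theta>: "(\<theta> has_vector_derivative w) (at t within S)"
  shows "((\<lambda>s. u (\<theta> s) x) has_real_derivative (\<Sum>j\<in>UNIV. w $ j * param_deriv u (\<theta> t) j x))
           (at t within S)"
proof -
  obtain D where D: "((\<lambda>\<eta>. u \<eta> x) has_derivative D) (at (\<theta> t))"
    using u by (auto simp: differentiable_def)
  interpret D: bounded_linear D
    using D by (rule has_derivative_bounded_linear)
  have "D w = D (\<Sum>j\<in>UNIV. w $ j *\<^sub>R axis j 1)"
    using basis_expansion[of w] by (simp add: scalar_mult_eq_scaleR)
  also have "\<dots> = (\<Sum>j\<in>UNIV. w $ j * param_deriv u (\<theta> t) j x)"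
    by (simp add: D.sum D.scaleR param_deriv_eq[where u = u, OF D])
  finally have Dw: "D w = (\<Sum>j\<in>UNIV. w $ j * param_deriv u (\<theta> t) j x)" .
  have "((\<lambda>s. u (\<theta> s) x) has_derivative (\<lambda>h. D (h *\<^sub>R w))) (at t within S)"
    using has_derivative_compose[OF \<theta>[unfolded has_vector_derivative_def] D] .
  then show ?thesis
    by (simp add: has_field_derivative_def D.scaleR Dw mult_commute_abs)
qed

text \<open>
  If the right-hand side is tangent to the trial manifold, its projection loses nothing and
  linearity of the inner product suffices. Integrability is assumed because the integral of a sum
  splits only when the summands are integrable.
\<close>

lemma NG_vector_eq_if_tangent:
  assumes tangent: "\<And>x. x \<in> \<Omega> \<Longrightarrow>
      eval_rhs \<Omega> F t (u \<theta>) x = (\<Sum>j\<in>UNIV. w $ j * param_deriv u \<theta> j x)"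
    and int: "\<And>i j. set_integrable lebesgue \<Omega> (\<lambda>x. param_deriv u \<theta> i x * param_deriv u \<theta> j x)"
  shows "NG_vector \<Omega> F u t \<theta> = NG_matrix \<Omega> u \<theta> *v w"
proof -
  have "L2_inner \<Omega> (param_deriv u \<theta> i) (eval_rhs \<Omega> F t (u \<theta>)) =
      (\<Sum>j\<in>UNIV. L2_inner \<Omega> (param_deriv u \<theta> i) (param_deriv u \<theta> j) * w $ j)" for i
  proof -
    have "L2_inner \<Omega> (param_deriv u \<theta> i) (eval_rhs \<Omega> F t (u \<theta>)) =
        (LINT x|lebesgue. (\<Sum>j\<in>UNIV.
           w $ j * (indicator \<Omega> x *\<^sub>R (param_deriv u \<theta> i x * param_deriv u \<theta> j x))))"
      unfolding L2_inner_def set_lebesgue_integral_def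
      by (rule Bochner_Integration.integral_cong)
        (auto simp: tangent sum_distrib_left ac_simps split: split_indicator)
    also have "\<dots> = (\<Sum>j\<in>UNIV. w $ j * L2_inner \<Omega> (param_deriv u \<theta> i) (param_deriv u \<theta> j))"
      using int unfolding set_integrable_def L2_inner_def set_lebesgue_integral_def
      by (subst Bochner_Integration.integral_sum) (auto simp: ac_simps)
    finally show ?thesis
      by (simp add: mult.commute)
  qed
  then show ?thesis
    by (simp add: NG_vector_def NG_matrix_def vec_eq_iff matrix_vector_mult_def)
qed

lemma NG_evolution_iff_if_tangent:
  assumes tangent: "\<And>t \<theta>. NG_vector \<Omega> F u t \<theta> = NG_matrix \<Omega> u \<theta> *v w"
    and inv: "\<And>\<theta>. invertible (NG_matrix \<Omega> u \<theta>)"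
  shows "NG_evolution \<Omega> F u T \<theta> \<longleftrightarrow>
    (\<forall>t\<in>{0..T}. (\<theta> has_vector_derivative w) (at t within {0..T}))"
proof -
  have "NG_matrix \<Omega> u \<eta> *v v = NG_matrix \<Omega> u \<eta> *v w \<longleftrightarrow> v = w" for \<eta> v
    using inj_matrix_vector_mult[OF inv[of \<eta>]] by (auto dest: injD)
  then show ?thesis
    by (simp add: NG_evolution_def tangent)
qed

text \<open>
  Uniqueness holds because \<open>\<theta> t - t w\<close> has derivative zero on an interval.
\<close>

lemma constant_velocity_iff:
  fixes \<theta> :: "real \<Rightarrow> 'a::real_normed_vector"
  assumes "T \<ge> 0"
  shows "(\<forall>t\<in>{0..T}. (\<theta> has_vector_derivative w) (at t within {0..T})) \<longleftrightarrow>
    (\<forall>t\<in>{0..T}. \<theta> t = \<theta> 0 + t *\<^sub>R w)" (is "?L \<longleftrightarrow> ?R")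
proof
  assume ?L
  then have "((\<lambda>s. \<theta> s - s *\<^sub>R w) has_vector_derivative 0) (at t within {0..T})"
    if "t \<in> {0..T}" for t
    using that by (auto intro!: derivative_eq_intros)
  then obtain c where c: "\<And>t. t \<in> {0..T} \<Longrightarrow> \<theta> t - t *\<^sub>R w = c"
    using has_vector_derivative_zero_constant[of "{0..T}" "\<lambda>s. \<theta> s - s *\<^sub>R w"] by auto
  from c[of 0] assms have "c = \<theta> 0"
    by simp
  with c show ?R
    by (metis diff_add_cancel)
next
  assume R: ?R
  show ?L
  proof
    fix t assume t: "t \<in> {0..T}"
    have "((\<lambda>s. \<theta> 0 + s *\<^sub>R w) has_vector_derivative w) (at t within {0..T})"
      by (auto intro!: derivative_eq_intros)
    then show "(\<theta> has_vector_derivative w) (at t within {0..T})"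
      by (rule has_vector_derivative_transform[OF t, rotated]) (use R in blast)
  qed
qed

section \<open>The exponential trial family\<close>

text \<open>
  The two claims support each other: the closed form of the \<open>k\<close>-th derivative is known only on the
  half-line, and this is enough to differentiate it there, one-sidedly at \<open>0\<close>, which yields the
  closed form of the next derivative.
\<close>

lemma spatial_deriv_trial_fun:
  assumes "x \<in> {0..}"
  shows "spatial_deriv {0..} k (trial_fun \<theta>) x = (- trial_beta \<theta> / 2) ^ k * trial_fun \<theta> x"
    and "(spatial_deriv {0..} k (trial_fun \<theta>) has_real_derivative
      (- trial_beta \<theta> / 2) ^ Suc k * trial_fun \<theta> x) (at x within {0..})"
proof -
  let ?b = "trial_beta \<theta>"
  have ex: "((\<lambda>x. (- ?b / 2) ^ k * trial_fun \<theta> x) has_real_derivative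
      (- ?b / 2) ^ Suc k * trial_fun \<theta> x) (at x within {0..})" for k x
    unfolding trial_fun_def by (auto intro!: derivative_eq_intros)
  have step: "(spatial_deriv {0..} k (trial_fun \<theta>) has_real_derivative
      (- ?b / 2) ^ Suc k * trial_fun \<theta> x) (at x within {0..})"
    if "\<And>y. y \<in> {0..} \<Longrightarrow> spatial_deriv {0..} k (trial_fun \<theta>) y = (- ?b / 2) ^ k * trial_fun \<theta> y"
      and "x \<in> {0..}" for k x
    using has_vector_derivative_transform[OF that(2) that(1)
        ex[unfolded has_real_derivative_iff_has_vector_derivative]]
    unfolding has_real_derivative_iff_has_vector_derivative .
  \<comment> \<open>One-sided derivatives at \<open>0\<close> are unique since \<open>0\<close> is not isolated in the half-line.\<close>
  have nbot: "at x within {0..} \<noteq> bot" if "x \<in> {0..}" for x :: real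
  proof -
    have "x islimpt {x..x+1}"
      by (simp add: islimpt_Icc)
    then have "x islimpt {0..}"
      using that by (elim islimpt_subset) auto
    then show ?thesis
      by (simp add: trivial_limit_within)
  qed
  have val: "spatial_deriv {0..} k (trial_fun \<theta>) x = (- ?b / 2) ^ k * trial_fun \<theta> x"
    if "x \<in> {0..}" for k x
    using that
  proof (induction k arbitrary: x)
    case (Suc k)
    show ?case
      unfolding spatial_deriv.simps
      by (rule vector_derivative_within[OF nbot[OF Suc.prems]
            step[OF Suc.IH Suc.prems, unfolded has_real_derivative_iff_has_vector_derivative]])
  qed simp
  show "spatial_deriv {0..} k (trial_fun \<theta>) x = (- ?b / 2) ^ k * trial_fun \<theta> x"
    by (rule val[OF assms])
  show "(spatial_deriv {0..} k (trial_fun \<theta>) has_real_derivative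
      (- ?b / 2) ^ Suc k * trial_fun \<theta> x) (at x within {0..})"
    by (rule step[OF val assms])
qed

lemma times_differentiable_on_trial_fun: "times_differentiable_on n {0..} (trial_fun \<theta>)"
  unfolding times_differentiable_on_def differentiable_on_def
  by (intro allI impI ballI
      differentiableI[OF has_field_derivative_imp_has_derivative[OF spatial_deriv_trial_fun(2)]])

lemma trial_fun_pos: "trial_fun \<theta> x > 0"
  by (simp add: trial_fun_def trial_alpha_def trial_beta_def)

lemma spatial_deriv_2_trial_fun_nonzero:
  "x \<in> {0..} \<Longrightarrow> spatial_deriv {0..} 2 (trial_fun \<theta>) x \<noteq> 0"
  using trial_fun_pos[of \<theta> x] by (simp add: spatial_deriv_trial_fun(1) trial_beta_def)

text \<open>
  In the logarithmic parameters the trial function is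
  \<open>exp (\<theta>\<^sub>0 + \<theta>\<^sub>1/2 - exp \<theta>\<^sub>1 x/2)\<close>, which avoids differentiating the square root.
\<close>

lemma has_derivative_trial_fun:
  "((\<lambda>\<eta>. trial_fun \<eta> x) has_derivative
     (\<lambda>h. (h $ 1 + (1 - trial_beta \<theta> * x) / 2 * h $ 2) * trial_fun \<theta> x)) (at \<theta>)"
proof -
  have sqrt_exp: "sqrt (exp y) = exp (y / 2)" for y :: real
    by (rule real_sqrt_unique) (simp_all add: power2_eq_square flip: exp_add)
  have "(\<lambda>\<eta>. trial_fun \<eta> x) = (\<lambda>\<eta>. exp (\<eta> $ 1 + \<eta> $ 2 / 2 - exp (\<eta> $ 2) * x / 2))"
    by (simp add: trial_fun_def trial_alpha_def trial_beta_def sqrt_exp flip: exp_add)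
  note eq = this fun_cong[OF this, of \<theta>]
  have nth: "((\<lambda>\<eta>. \<eta> $ i) has_derivative (\<lambda>h. h $ i)) (at \<theta>)" for i
    by (rule bounded_linear_imp_has_derivative[OF bounded_linear_vec_nth])
  have "((\<lambda>\<eta>. exp (\<eta> $ 1 + \<eta> $ 2 / 2 - exp (\<eta> $ 2) * x / 2)) has_derivative
      (\<lambda>h. exp (\<theta> $ 1 + \<theta> $ 2 / 2 - exp (\<theta> $ 2) * x / 2) *
           (h $ 1 + h $ 2 / 2 - exp (\<theta> $ 2) * h $ 2 * x / 2))) (at \<theta>)"
    by (rule derivative_eq_intros nth refl | simp add: fun_eq_iff mult_ac)+
  also have "(\<lambda>h::real^2. exp (\<theta> $ 1 + \<theta> $ 2 / 2 - exp (\<theta> $ 2) * x / 2) *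
           (h $ 1 + h $ 2 / 2 - exp (\<theta> $ 2) * h $ 2 * x / 2)) =
      (\<lambda>h. (h $ 1 + (1 - trial_beta \<theta> * x) / 2 * h $ 2) * trial_fun \<theta> x)"
    unfolding eq(2) trial_beta_def by (rule ext) (simp add: field_simps)
  finally show ?thesis
    unfolding eq(1) .
qed

lemma param_deriv_trial_fun:
  "param_deriv trial_fun \<theta> 1 x = trial_fun \<theta> x"
  "param_deriv trial_fun \<theta> 2 x = (1 - trial_beta \<theta> * x) / 2 * trial_fun \<theta> x"
  by (simp_all add: param_deriv_eq[where u = trial_fun, OF has_derivative_trial_fun] axis_def)

text \<open>
  The parameter velocity \<open>w\<close>: its components solve \<open>w\<^sub>0 + (1 - \<beta>x)/2 \<cdot> w\<^sub>1 = - (\<lambda>\<^sup>2 + r \<beta>x)/2\<close>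
  identically in \<open>\<beta>x\<close>.
\<close>

definition velocity :: "real \<Rightarrow> real \<Rightarrow> real^2" where
  "velocity r lam = vector [- (1/2) * (lam\<^sup>2 + r), r]"

text \<open>
  The nonlinear term becomes linear on the trial family because \<open>u\<^sub>x\<^sup>2 = u u\<^sub>x\<^sub>x\<close> for exponentials.
\<close>

lemma eval_rhs_trial_fun:
  assumes "x \<in> {0..}"
  shows "eval_rhs {0..} (IVP_rhs r lam) t (trial_fun \<theta>) x =
    (- lam\<^sup>2 / 2 + - r / 2 * (trial_beta \<theta> * x)) * trial_fun \<theta> x"
proof -
  have "trial_beta \<theta> > 0"
    by (simp add: trial_beta_def)
  with trial_fun_pos[of \<theta> x] show ?thesis
    unfolding eval_rhs_def IVP_rhs_def spatial_deriv_trial_fun(1)[OF assms]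
    by (simp add: field_simps power2_eq_square)
qed

lemma eval_rhs_trial_fun_tangent:
  assumes "x \<in> {0..}"
  shows "eval_rhs {0..} (IVP_rhs r lam) t (trial_fun \<theta>) x =
    (\<Sum>j\<in>UNIV. velocity r lam $ j * param_deriv trial_fun \<theta> j x)"
  by (simp add: eval_rhs_trial_fun[OF assms] sum_2 param_deriv_trial_fun velocity_def field_simps)

section \<open>The Gram matrix\<close>

lemma has_bochner_integral_erlang_density:
  assumes "b > 0"
  shows "has_bochner_integral lborel (erlang_density k b) 1"
proof -
  have "(\<integral>\<^sup>+x. ennreal (erlang_density k b x) \<partial>lborel) = ennreal 1"
    using prob_space.emeasure_space_1[OF prob_space_erlang_density[OF assms, of k]]
    by (simp add: emeasure_density)
  then show ?thesis
    using assms by (intro has_bochner_integral_nn_integral) auto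
qed

text \<open>
  The Erlang density of shape index \<open>k\<close> is \<open>(b x)\<^sup>k b exp (- b x) / k!\<close> on the half-line, so that
  \<open>(b x)\<^sup>k\<close> has the moment \<open>k!\<close>.
\<close>

lemma quadratic_exponential_integral:
  fixes b :: real
  assumes "b > 0"
  shows "has_bochner_integral lebesgue
    (\<lambda>x. indicator {0..} x *\<^sub>R ((c\<^sub>0 + c\<^sub>1 * (b * x) + c\<^sub>2 * (b * x)\<^sup>2) * (b * exp (- b * x))))
    (c\<^sub>0 + c\<^sub>1 + 2 * c\<^sub>2)"
proof -
  let ?e = "\<lambda>k. erlang_density k b"
  have "has_bochner_integral lborel (\<lambda>x. c\<^sub>0 * ?e 0 x + c\<^sub>1 * ?e 1 x + 2 * c\<^sub>2 * ?e 2 x)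
      (c\<^sub>0 * 1 + c\<^sub>1 * 1 + 2 * c\<^sub>2 * 1)"
    by (intro has_bochner_integral_add has_bochner_integral_mult_right
        has_bochner_integral_erlang_density assms)
  moreover have "c\<^sub>0 * ?e 0 x + c\<^sub>1 * ?e 1 x + 2 * c\<^sub>2 * ?e 2 x =
      indicator {0..} x *\<^sub>R ((c\<^sub>0 + c\<^sub>1 * (b * x) + c\<^sub>2 * (b * x)\<^sup>2) * (b * exp (- b * x)))" for x
    by (auto simp: erlang_density_def algebra_simps power2_eq_square numeral_2_eq_2
        split: split_indicator)
  ultimately show ?thesis
    by (simp add: has_bochner_integral_iff integrable_completion integral_completion)
qed

text \<open>
  Both parameter derivatives and the right-hand side have the form \<open>(p\<^sub>0 + p\<^sub>1 \<beta>x) u\<^sub>\<theta>\<close>, so this one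
  formula gives all the inner products and all the square integrability that is required.
\<close>

lemma trial_fun_linear_products:
  fixes \<theta> :: "real^2" and p\<^sub>0 p\<^sub>1 q\<^sub>0 q\<^sub>1 :: real
  defines "f \<equiv> \<lambda>x. (p\<^sub>0 + p\<^sub>1 * (trial_beta \<theta> * x)) * trial_fun \<theta> x"
    and "g \<equiv> \<lambda>x. (q\<^sub>0 + q\<^sub>1 * (trial_beta \<theta> * x)) * trial_fun \<theta> x"
  shows "set_integrable lebesgue {0..} (\<lambda>x. f x * g x)"
    and "L2_inner {0..} f g =
      (trial_alpha \<theta>)\<^sup>2 * (p\<^sub>0 * q\<^sub>0 + p\<^sub>0 * q\<^sub>1 + p\<^sub>1 * q\<^sub>0 + 2 * (p\<^sub>1 * q\<^sub>1))"
proof -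
  let ?a = "trial_alpha \<theta>" and ?b = "trial_beta \<theta>"
  have b: "?b > 0"
    by (simp add: trial_beta_def)
  have square: "trial_fun \<theta> x * trial_fun \<theta> x = ?a\<^sup>2 * (?b * exp (- ?b * x))" for x
  proof -
    let ?e = "exp (- (1/2) * ?b * x)"
    have "trial_fun \<theta> x * trial_fun \<theta> x = (?a * ?a) * ((sqrt ?b * sqrt ?b) * (?e * ?e))"
      unfolding trial_fun_def by (simp only: ac_simps)
    moreover have "?e * ?e = exp (- ?b * x)"
      by (simp flip: exp_add)
    moreover have "sqrt ?b * sqrt ?b = ?b"
      using b by simp
    ultimately show ?thesis
      by (simp only: power2_eq_square)
  qed
  have "f x * g x = ?a\<^sup>2 * ((p\<^sub>0 * q\<^sub>0 + (p\<^sub>0 * q\<^sub>1 + p\<^sub>1 * q\<^sub>0) * (?b * x) + p\<^sub>1 * q\<^sub>1 * (?b * x)\<^sup>2) *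
      (?b * exp (- ?b * x)))" for x
  proof -
    have "f x * g x = (p\<^sub>0 * q\<^sub>0 + (p\<^sub>0 * q\<^sub>1 + p\<^sub>1 * q\<^sub>0) * (?b * x) + p\<^sub>1 * q\<^sub>1 * (?b * x)\<^sup>2) *
        (trial_fun \<theta> x * trial_fun \<theta> x)"
      unfolding f_def g_def by algebra
    then show ?thesis
      unfolding square by simp
  qed
  then have "has_bochner_integral lebesgue (\<lambda>x. indicator {0..} x *\<^sub>R (f x * g x))
      (?a\<^sup>2 * (p\<^sub>0 * q\<^sub>0 + (p\<^sub>0 * q\<^sub>1 + p\<^sub>1 * q\<^sub>0) + 2 * (p\<^sub>1 * q\<^sub>1)))"
    using has_bochner_integral_mult_right[OF quadratic_exponential_integral[OF b,
        of "p\<^sub>0 * q\<^sub>0" "p\<^sub>0 * q\<^sub>1 + p\<^sub>1 * q\<^sub>0" "p\<^sub>1 * q\<^sub>1"], of "?a\<^sup>2"]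
    by (simp add: ac_simps)
  then show "set_integrable lebesgue {0..} (\<lambda>x. f x * g x)"
    and "L2_inner {0..} f g =
      ?a\<^sup>2 * (p\<^sub>0 * q\<^sub>0 + p\<^sub>0 * q\<^sub>1 + p\<^sub>1 * q\<^sub>0 + 2 * (p\<^sub>1 * q\<^sub>1))"
    unfolding set_integrable_def L2_inner_def set_lebesgue_integral_def has_bochner_integral_iff
    by (simp_all add: add.assoc)
qed

lemma in_L2_trial_fun_linear:
  assumes "\<And>x. x \<in> {0..} \<Longrightarrow> f x = (p\<^sub>0 + p\<^sub>1 * (trial_beta \<theta> * x)) * trial_fun \<theta> x"
  shows "in_L2 {0..} f"
proof -
  let ?g = "\<lambda>x. (p\<^sub>0 + p\<^sub>1 * (trial_beta \<theta> * x)) * trial_fun \<theta> x"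
  have eq: "(\<lambda>x. indicator {0..} x *\<^sub>R f x) = (\<lambda>x. indicator {0..} x *\<^sub>R ?g x)"
    "(\<lambda>x. indicator {0..} x *\<^sub>R (f x)\<^sup>2) = (\<lambda>x. indicator {0..} x *\<^sub>R (?g x * ?g x))"
    using assms by (auto simp: fun_eq_iff power2_eq_square split: split_indicator)
  have "(\<lambda>x. indicator {0..} x *\<^sub>R ?g x) \<in> borel_measurable borel"
    unfolding trial_fun_def by measurable
  then have "(\<lambda>x. indicator {0..} x *\<^sub>R ?g x) \<in> borel_measurable lebesgue"
    by (intro measurable_completion) simp
  moreover have "set_integrable lebesgue {0..} (\<lambda>x. ?g x * ?g x)"
    by (rule trial_fun_linear_products)
  ultimately show ?thesis
    unfolding in_L2_def set_borel_measurable_def set_integrable_def eq by simp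
qed

text \<open>
  The coefficients \<open>(p\<^sub>0, p\<^sub>1)\<close> of the parameter derivatives in the form \<open>(p\<^sub>0 + p\<^sub>1 \<beta>x) u\<^sub>\<theta>\<close>, as a
  function of the index, so that statements about all entries of the Gram matrix need no case
  distinction.
\<close>

definition param_coeffs :: "2 \<Rightarrow> real \<times> real" where
  "param_coeffs i = (if i = 1 then (1, 0) else (1/2, - (1/2)))"

lemma param_deriv_trial_fun_linear:
  "param_deriv trial_fun \<theta> i = (\<lambda>x. (fst (param_coeffs i) +
     snd (param_coeffs i) * (trial_beta \<theta> * x)) * trial_fun \<theta> x)"
proof (cases "i = 1")
  case False
  then have "i = 2"
    using exhaust_2 by blast
  then show ?thesis
    using False by (simp add: fun_eq_iff param_deriv_trial_fun(2) param_coeffs_def diff_divide_distrib)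
qed (simp add: fun_eq_iff param_deriv_trial_fun(1) param_coeffs_def)

lemma in_L2_param_deriv_trial_fun: "in_L2 {0..} (param_deriv trial_fun \<theta> i)"
  by (rule in_L2_trial_fun_linear) (simp add: param_deriv_trial_fun_linear)

lemma NG_matrix_trial_fun:
  "NG_matrix {0..} trial_fun \<theta> =
     (trial_alpha \<theta>)\<^sup>2 *\<^sub>R vector [vector [1, 0], vector [0, 1/4]]"
  by (simp add: vec_eq_iff forall_2 NG_matrix_def param_deriv_trial_fun_linear
      trial_fun_linear_products(2) param_coeffs_def)

lemma invertible_NG_matrix_trial_fun: "invertible (NG_matrix {0..} trial_fun \<theta>)"
  by (simp add: invertible_det_nz NG_matrix_trial_fun det_2 trial_alpha_def)

lemma NG_vector_trial_fun_tangent: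
  "NG_vector {0..} (IVP_rhs r lam) trial_fun t \<theta> =
     NG_matrix {0..} trial_fun \<theta> *v velocity r lam"
  by (rule NG_vector_eq_if_tangent[OF eval_rhs_trial_fun_tangent])
    (simp_all add: param_deriv_trial_fun_linear trial_fun_linear_products(1))

section \<open>Solution of the parameter equation and of the initial value problem\<close>

lemmas NG_evolution_trial_fun_iff =
  NG_evolution_iff_if_tangent[OF NG_vector_trial_fun_tangent invertible_NG_matrix_trial_fun]

text \<open>
  Taking logarithms turns the explicit formulas for \<open>\<alpha>\<close> and \<open>\<beta>\<close> into the componentwise equation of
  the line through \<open>(ln 2, 0)\<close> with velocity \<open>w\<close>.
\<close>

lemma NG_evolution_explicit:
  assumes "T \<ge> 0"
  shows "NG_evolution {0..} (IVP_rhs r lam) trial_fun T \<theta> \<and>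
      trial_alpha (\<theta> 0) = 2 \<and> trial_beta (\<theta> 0) = 1 \<longleftrightarrow>
    (\<forall>t\<in>{0..T}. trial_alpha (\<theta> t) = 2 * exp (- (1/2) * (lam\<^sup>2 + r) * t) \<and>
                trial_beta (\<theta> t) = exp (r * t))" (is "?L \<longleftrightarrow> ?R")
proof -
  have alpha: "trial_alpha \<eta> = 2 * exp s \<longleftrightarrow> \<eta> $ 1 = ln 2 + s" for \<eta> s
  proof -
    have "2 * exp s = exp (ln 2 + s)"
      by (simp add: exp_add)
    then show ?thesis
      by (simp only: trial_alpha_def exp_inj_iff)
  qed
  have beta: "trial_beta \<eta> = exp s \<longleftrightarrow> \<eta> $ 2 = s" for \<eta> s
    by (simp add: trial_beta_def)
  let ?C = "\<lambda>t. \<theta> t $ 1 = ln 2 + - (1/2) * (lam\<^sup>2 + r) * t \<and> \<theta> t $ 2 = r * t"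
  have "?L \<longleftrightarrow> (\<forall>t\<in>{0..T}. \<theta> t = \<theta> 0 + t *\<^sub>R velocity r lam) \<and> ?C 0"
    using alpha[of "\<theta> 0" 0] beta[of "\<theta> 0" 0]
    by (simp add: NG_evolution_trial_fun_iff constant_velocity_iff[OF assms])
  also have "\<dots> \<longleftrightarrow> (\<forall>t\<in>{0..T}. ?C t)"
  proof -
    have "\<theta> t = \<theta> 0 + t *\<^sub>R velocity r lam \<longleftrightarrow> ?C t" if "?C 0" for t
      using that by (simp add: vec_eq_iff forall_2 velocity_def mult.commute)
    moreover have "(0::real) \<in> {0..T}"
      using assms by simp
    ultimately show ?thesis
      by blast
  qed
  also have "\<dots> \<longleftrightarrow> ?R"
    by (simp only: alpha beta)
  finally show ?thesis .
qed

lemma trial_fun_initial: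
  assumes "trial_alpha \<eta> = 2" "trial_beta \<eta> = 1"
  shows "trial_fun \<eta> x = 2 * exp (- (1/2) * x)"
  using assms by (simp add: trial_fun_def)

text \<open>
  Both sides of the differential equation are the same tangent vector \<open>\<Sum>\<^sub>j w\<^sub>j \<partial>u/\<partial>\<theta>\<^sub>j\<close>: the left
  one by the chain rule, the right one by tangency.
\<close>

lemma solves_IVP_trial_fun:
  assumes "NG_evolution {0..} (IVP_rhs r lam) trial_fun T \<theta>"
    and "trial_alpha (\<theta> 0) = 2" "trial_beta (\<theta> 0) = 1"
  shows "solves_IVP r lam T (\<lambda>t. trial_fun (\<theta> t))"
  unfolding solves_IVP_def
proof (intro conjI ballI)
  fix t x :: real
  assume t: "t \<in> {0..T}" and x: "x \<in> {0..}"
  have "(\<theta> has_vector_derivative velocity r lam) (at t within {0..T})"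
    using assms(1) t by (simp add: NG_evolution_trial_fun_iff)
  moreover have "(\<lambda>\<eta>. trial_fun \<eta> x) differentiable (at (\<theta> t))"
    using has_derivative_trial_fun by (rule differentiableI)
  ultimately show "((\<lambda>s. trial_fun (\<theta> s) x) has_real_derivative
      eval_rhs {0..} (IVP_rhs r lam) t (trial_fun (\<theta> t)) x) (at t within {0..T})"
    unfolding eval_rhs_trial_fun_tangent[OF x] by (intro chain_rule_param_deriv)
qed (simp_all only: times_differentiable_on_trial_fun trial_fun_initial[OF assms(2,3)]
      spatial_deriv_2_trial_fun_nonzero not_False_eq_True)

theorem mainTheorem1:
  fixes r lam T :: real
  assumes "T > 0"
  shows
    "\<comment> \<open>the trial family is differentiable in \<open>\<theta>\<close>, and \<open>F\<close> and all inner products are well defined\<close>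
     (\<forall>\<theta>. (\<forall>x\<in>{0..}. (\<lambda>\<eta>. trial_fun \<eta> x) differentiable (at \<theta>)) \<and>
          times_differentiable_on 2 {0..} (trial_fun \<theta>) \<and>
          (\<forall>x\<in>{0..}. spatial_deriv {0..} 2 (trial_fun \<theta>) x \<noteq> 0) \<and>
          (\<forall>i. in_L2 {0..} (param_deriv trial_fun \<theta> i)) \<and>
          (\<forall>t. in_L2 {0..} (eval_rhs {0..} (IVP_rhs r lam) t (trial_fun \<theta>)))) \<and>
     (\<forall>\<theta>. NG_matrix {0..} trial_fun \<theta> =
          (trial_alpha \<theta>)\<^sup>2 *\<^sub>R vector [vector [1, 0], vector [0, 1/4]]) \<and>
     (\<forall>t \<theta>. NG_vector {0..} (IVP_rhs r lam) trial_fun t \<theta> =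
          (trial_alpha \<theta>)\<^sup>2 *\<^sub>R vector [- (1/2) * (lam\<^sup>2 + r), 1/4 * r]) \<and>
     (\<forall>\<eta>. trial_alpha \<eta> = 2 \<and> trial_beta \<eta> = 1 \<longrightarrow>
          (\<forall>x\<in>{0..}. trial_fun \<eta> x = 2 * exp (- (1/2) * x))) \<and>
     \<comment> \<open>existence and uniqueness of the solution of the evolution equation on \<open>[0,T]\<close>\<close>
     (\<forall>\<theta>. NG_evolution {0..} (IVP_rhs r lam) trial_fun T \<theta> \<and>
            trial_alpha (\<theta> 0) = 2 \<and> trial_beta (\<theta> 0) = 1 \<longleftrightarrow>
          (\<forall>t\<in>{0..T}. trial_alpha (\<theta> t) = 2 * exp (- (1/2) * (lam\<^sup>2 + r) * t) \<and>
                      trial_beta (\<theta> t) = exp (r * t))) \<and>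
     (\<forall>\<theta>. NG_evolution {0..} (IVP_rhs r lam) trial_fun T \<theta> \<and>
            trial_alpha (\<theta> 0) = 2 \<and> trial_beta (\<theta> 0) = 1 \<longrightarrow>
          solves_IVP r lam T (\<lambda>t. trial_fun (\<theta> t))) \<and>
     solves_IVP r lam T
       (\<lambda>t x. 2 * exp (- (1/2) * (lam\<^sup>2 + r) * t) * sqrt (exp (r * t)) *
              exp (- (1/2) * exp (r * t) * x))"
proof -
  \<comment> \<open>A parameter curve realising the explicit formulas; the last claim is about this curve.\<close>
  define \<theta> :: "real \<Rightarrow> real^2" where
    "\<theta> t = vector [ln 2 + - (1/2) * (lam\<^sup>2 + r) * t, r * t]" for t
  have \<theta>: "trial_alpha (\<theta> t) = 2 * exp (- (1/2) * (lam\<^sup>2 + r) * t)"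
    "trial_beta (\<theta> t) = exp (r * t)" for t
    unfolding trial_alpha_def trial_beta_def \<theta>_def vector_2 by (simp_all only: exp_add exp_ln)
  have "solves_IVP r lam T (\<lambda>t. trial_fun (\<theta> t))"
    using NG_evolution_explicit[of T r lam \<theta>] \<theta> assms by (intro solves_IVP_trial_fun) auto
  then have explicit: "solves_IVP r lam T
      (\<lambda>t x. 2 * exp (- (1/2) * (lam\<^sup>2 + r) * t) * sqrt (exp (r * t)) *
             exp (- (1/2) * exp (r * t) * x))"
    unfolding trial_fun_def \<theta> .
  have vec: "NG_vector {0..} (IVP_rhs r lam) trial_fun t \<eta> =
      (trial_alpha \<eta>)\<^sup>2 *\<^sub>R vector [- (1/2) * (lam\<^sup>2 + r), 1/4 * r]" for t \<eta>
    by (simp add: NG_vector_trial_fun_tangent NG_matrix_trial_fun vec_eq_iff forall_2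
        matrix_vector_mult_def sum_2 velocity_def)
  have L2: "in_L2 {0..} (eval_rhs {0..} (IVP_rhs r lam) t (trial_fun \<eta>))" for t \<eta>
    by (rule in_L2_trial_fun_linear) (rule eval_rhs_trial_fun)
  show ?thesis
    by (intro conjI allI ballI impI)
      (assumption | erule conjE
        | rule explicit differentiableI[OF has_derivative_trial_fun]
          times_differentiable_on_trial_fun spatial_deriv_2_trial_fun_nonzero
          in_L2_param_deriv_trial_fun L2 NG_matrix_trial_fun vec
          NG_evolution_explicit[OF less_imp_le[OF assms]]
        | rule trial_fun_initial solves_IVP_trial_fun)+
qed

end
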